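(* Let $Z$ be a rectangle in the $xy$ plane. Then there is a unique ellipse inscribed in $Z$ which is tangent to the four sides of $Z$ at their midpoints; call it the midpoint ellipse $E_M$. Moreover, $E_M$ has the following properties: (A) $E_M$ is the unique ellipse of minimal eccentricity inscribed in $Z$. (B) $E_M$ is the unique ellipse of maximal area inscribed in $Z$. (C) $E_M$ is the unique ellipse of maximal arc length inscribed in $Z$.
   Context: Rectangles are nondegenerate. An ellipse (circles are allowed) is inscribed in a rectangle $Z$ if it lies in $Z$ and is tangent to each of the four sides of $Z$. If $a\ge b>0$ are the lengths of the semi-major and semi-minor axes of an ellipse, its eccentricity is $\sqrt{1-b^2/a^2}$ (so a circle has eccentricity $0$). The area of an ellipse is the area of the region it encloses, and its arc length is its perimeter. Minimal and maximal are meant among all ellipses inscribed in $Z$. *)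

theory Defs
  imports "HOL-Analysis.Analysis"
begin

type_synonym point = "real^2"

text \<open>The vertices are listed in cyclic order.\<close>

definition rectangle :: "point \<Rightarrow> point \<Rightarrow> point \<Rightarrow> point \<Rightarrow> bool" where
  "rectangle A B C D \<longleftrightarrow>
     A \<noteq> B \<and> A \<noteq> D \<and> (B - A) \<bullet> (D - A) = 0 \<and> C - D = B - A"

definition rectangle_region :: "point \<Rightarrow> point \<Rightarrow> point \<Rightarrow> point \<Rightarrow> point set" where
  "rectangle_region A B C D = convex hull {A, B, C, D}"

text \<open>
  The curve with centre \<open>c\<close>, semi-axis directions \<open>u\<close>, \<open>v\<close> and semi-axis lengths \<open>a\<close>, \<open>b\<close>.
  It runs through the ellipse once as the parameter increases from \<open>0\<close> to \<open>2 * pi\<close>.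
\<close>

definition ellipse_param :: "point \<Rightarrow> point \<Rightarrow> point \<Rightarrow> real \<Rightarrow> real \<Rightarrow> real \<Rightarrow> point" where
  "ellipse_param c u v a b t = c + (a * cos t) *\<^sub>R u + (b * sin t) *\<^sub>R v"

definition ellipse_with ::
    "point \<Rightarrow> point \<Rightarrow> point \<Rightarrow> real \<Rightarrow> real \<Rightarrow> point set \<Rightarrow> bool" where
  "ellipse_with c u v a b E \<longleftrightarrow>
     norm u = 1 \<and> norm v = 1 \<and> u \<bullet> v = 0 \<and> 0 < b \<and> b \<le> a \<and>
     E = range (ellipse_param c u v a b)"

text \<open>An ellipse is the curve itself, as a set of points.\<close>

definition is_ellipse :: "point set \<Rightarrow> bool" where
  "is_ellipse E \<longleftrightarrow> (\<exists>c u v a b. ellipse_with c u v a b E)"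

text \<open>
  The lengths \<open>a\<close> and \<open>b\<close> are determined by the set \<open>E\<close>, and the directions only up to sign (for a
  circle, up to any orthogonal change), so eccentricity and arc length below do not depend
  on the choice of the parametrization.
\<close>

definition eccentricity :: "point set \<Rightarrow> real" where
  "eccentricity E =
     (THE e. \<exists>c u v a b. ellipse_with c u v a b E \<and> e = sqrt (1 - b\<^sup>2 / a\<^sup>2))"

definition ellipse_area :: "point set \<Rightarrow> real" where
  "ellipse_area E = measure lebesgue (inside E)"

definition curve_length :: "(real \<Rightarrow> point) \<Rightarrow> real \<Rightarrow> real \<Rightarrow> real" where
  "curve_length g s t = integral {s..t} (\<lambda>x. norm (vector_derivative g (at x)))"

definition arc_length :: "point set \<Rightarrow> real" where
  "arc_length E =
     (THE L. \<exists>c u v a b. ellipse_with c u v a b E \<and>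
        L = curve_length (ellipse_param c u v a b) 0 (2 * pi))"

definition tangent_line :: "point set \<Rightarrow> point \<Rightarrow> point set \<Rightarrow> bool" where
  "tangent_line E x l \<longleftrightarrow>
     (\<exists>c u v a b t. ellipse_with c u v a b E \<and> ellipse_param c u v a b t = x \<and>
        l = range (\<lambda>s. x + s *\<^sub>R vector_derivative (ellipse_param c u v a b) (at t)))"

definition tangent_to_side_at :: "point set \<Rightarrow> point \<Rightarrow> point \<Rightarrow> point \<Rightarrow> bool" where
  "tangent_to_side_at E P Q x \<longleftrightarrow>
     x \<in> closed_segment P Q \<and> tangent_line E x (affine hull {P, Q})"

definition tangent_to_side :: "point set \<Rightarrow> point \<Rightarrow> point \<Rightarrow> bool" where
  "tangent_to_side E P Q \<longleftrightarrow> (\<exists>x. tangent_to_side_at E P Q x)"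

definition inscribed :: "point \<Rightarrow> point \<Rightarrow> point \<Rightarrow> point \<Rightarrow> point set \<Rightarrow> bool" where
  "inscribed A B C D E \<longleftrightarrow>
     is_ellipse E \<and> E \<subseteq> rectangle_region A B C D \<and>
     tangent_to_side E A B \<and> tangent_to_side E B C \<and>
     tangent_to_side E C D \<and> tangent_to_side E D A"

definition midpoint_ellipse :: "point \<Rightarrow> point \<Rightarrow> point \<Rightarrow> point \<Rightarrow> point set \<Rightarrow> bool" where
  "midpoint_ellipse A B C D E \<longleftrightarrow>
     inscribed A B C D E \<and>
     tangent_to_side_at E A B (midpoint A B) \<and> tangent_to_side_at E B C (midpoint B C) \<and>
     tangent_to_side_at E C D (midpoint C D) \<and> tangent_to_side_at E D A (midpoint D A)"

end

theory Submission
  imports Defs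
begin

text \<open>
  Let \<open>p\<close>, \<open>q\<close> be the sides of the rectangle. The support function of an ellipse with semi-axes
  \<open>a\<close>, \<open>b\<close> is the square root of a quadratic form with trace \<open>a\<^sup>2 + b\<^sup>2\<close> and determinant
  \<open>(a * b)\<^sup>2\<close>. Touching the four sides forces the centre to be that of the rectangle and prescribes
  the form on \<open>p\<close> and on \<open>q\<close>; only its off-diagonal entry \<open>s\<close> remains free. Hence \<open>a\<^sup>2 + b\<^sup>2\<close> is
  the same for all inscribed ellipses, while \<open>(a * b)\<^sup>2\<close> is largest exactly for \<open>s = 0\<close>, the midpoint
  ellipse. For fixed \<open>a\<^sup>2 + b\<^sup>2\<close>, the area and the arc length strictly increase with \<open>a * b\<close> and the
  eccentricity strictly decreases.
\<close>

section \<open>The quarter turn of the plane\<close>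

text \<open>For nonzero \<open>p\<close>, the pair \<open>p\<close>, \<open>rot90 p\<close> is
  orthogonal with equal lengths, so trace and determinant can be computed on it without normalising
  \<open>p\<close>.\<close>

definition rot90 :: "point \<Rightarrow> point" where
  "rot90 x = vector [- x$2, x$1]"

lemma rot90_nth [simp]: "rot90 x $ 1 = - x$2" "rot90 x $ 2 = x$1"
  by (simp_all add: rot90_def)

lemma inner_point: "(x::point) \<bullet> y = x$1 * y$1 + x$2 * y$2"
  by (simp add: inner_vec_def sum_2)

lemma point_eq_iff: "(x::point) = y \<longleftrightarrow> x$1 = y$1 \<and> x$2 = y$2"
  by (simp add: vec_eq_iff forall_2)

lemma inner_rot90_rot90 [simp]: "rot90 x \<bullet> rot90 y = x \<bullet> y"
  by (simp add: inner_point)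

lemma inner_rot90_self [simp]: "x \<bullet> rot90 x = 0" "rot90 x \<bullet> x = 0"
  by (simp_all add: inner_point)

text \<open>Expansion in the orthogonal pair \<open>p\<close>, \<open>rot90 p\<close>, cleared of
  the denominator \<open>p \<bullet> p\<close>.\<close>

lemma rot90_expand:
  "(p \<bullet> p) *\<^sub>R z = (z \<bullet> p) *\<^sub>R p + (z \<bullet> rot90 p) *\<^sub>R rot90 p"
  by (simp add: point_eq_iff inner_point algebra_simps)

lemma orthogonal_imp_scaled_rot90:
  assumes "p \<noteq> 0" "p \<bullet> q = 0"
  obtains \<tau> where "q = \<tau> *\<^sub>R rot90 p"
proof
  have "(p \<bullet> p) *\<^sub>R q = (q \<bullet> rot90 p) *\<^sub>R rot90 p"
    using rot90_expand[of p q] assms by (simp add: inner_commute)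
  then have "(1 / (p \<bullet> p)) *\<^sub>R (p \<bullet> p) *\<^sub>R q = (1 / (p \<bullet> p)) *\<^sub>R (q \<bullet> rot90 p) *\<^sub>R rot90 p"
    by (rule arg_cong)
  then show "q = ((q \<bullet> rot90 p) / (p \<bullet> p)) *\<^sub>R rot90 p"
    using assms by simp
qed

text \<open>Orthogonality makes \<open>v\<close> a multiple of \<open>rot90 u\<close>; unit length
  leaves only the sign open.\<close>

lemma orthonormal_imp_rot90:
  assumes "norm u = 1" "norm v = 1" "u \<bullet> v = 0"
  shows "v = rot90 u \<or> v = - rot90 u"
proof -
  have "u \<noteq> 0" using assms(1) by auto
  then obtain \<tau> where \<tau>: "v = \<tau> *\<^sub>R rot90 u"
    using orthogonal_imp_scaled_rot90 assms(3) by blast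
  have "norm (rot90 u) = 1"
    using assms(1) by (simp add: norm_eq_sqrt_inner)
  then have "\<bar>\<tau>\<bar> = 1" using assms(2) \<tau> by simp
  then show ?thesis using \<tau> by (auto simp: abs_if split: if_splits)
qed

section \<open>The quadratic form of an ellipse\<close>

text \<open>
  The square of the support function of the ellipse centred at \<open>0\<close>, polarised.
\<close>

definition ellipse_form :: "point \<Rightarrow> point \<Rightarrow> real \<Rightarrow> real \<Rightarrow> point \<Rightarrow> point \<Rightarrow> real" where
  "ellipse_form u v a b w z = a\<^sup>2 * (u \<bullet> w) * (u \<bullet> z) + b\<^sup>2 * (v \<bullet> w) * (v \<bullet> z)"

lemma ellipse_form_bilinear:
  "ellipse_form u v a b (\<alpha> *\<^sub>R w + \<beta> *\<^sub>R z) (\<alpha> *\<^sub>R w + \<beta> *\<^sub>R z) =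
    \<alpha>\<^sup>2 * ellipse_form u v a b w w + 2 * \<alpha> * \<beta> * ellipse_form u v a b w z
      + \<beta>\<^sup>2 * ellipse_form u v a b z z"
  by (simp add: ellipse_form_def inner_right_distrib algebra_simps power2_eq_square)

lemma ellipse_form_scale:
  "ellipse_form u v a b (\<alpha> *\<^sub>R w) (\<alpha> *\<^sub>R w) = \<alpha>\<^sup>2 * ellipse_form u v a b w w"
  by (simp add: ellipse_form_def algebra_simps power2_eq_square)

text \<open>The open sign of \<open>v\<close> cancels, since \<open>v\<close> enters through a
  product of two factors. What remains is polynomial in coordinates, within reach of
  \<open>algebra\<close>.\<close>

lemma ellipse_form_rot90:
  assumes "ellipse_with c u v a b E"
  shows "ellipse_form u v a b w z = a\<^sup>2 * (u \<bullet> w) * (u \<bullet> z) + b\<^sup>2 * (rot90 u \<bullet> w) * (rot90 u \<bullet> z)"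
  using orthonormal_imp_rot90[of u v] assms by (auto simp: ellipse_with_def ellipse_form_def)

text \<open>The eigenvalues are \<open>a\<^sup>2\<close> and \<open>b\<^sup>2\<close>, and the trace
  is the same in every orthonormal basis; \<open>p \<bullet> p\<close> accounts for the length of
  \<open>p\<close>.\<close>

lemma ellipse_form_trace:
  assumes "ellipse_with c u v a b E"
  shows "ellipse_form u v a b p p + ellipse_form u v a b (rot90 p) (rot90 p) = (a\<^sup>2 + b\<^sup>2) * (p \<bullet> p)"
proof -
  have "u \<bullet> u = 1" using assms by (auto simp: ellipse_with_def norm_eq_1)
  \<comment> \<open>The factor \<open>u \<bullet> u\<close> makes this a polynomial identity that
    holds before \<open>u\<close> is normalised.\<close>
  moreover have "ellipse_form u v a b p p + ellipse_form u v a b (rot90 p) (rot90 p)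
      = (a\<^sup>2 + b\<^sup>2) * (p \<bullet> p) * (u \<bullet> u)"
    unfolding ellipse_form_rot90[OF assms] inner_point rot90_nth by algebra
  ultimately show ?thesis by simp
qed

text \<open>Product of the eigenvalues; the change of basis to \<open>p\<close>,
  \<open>rot90 p\<close> contributes \<open>(p \<bullet> p)\<^sup>2\<close>.\<close>

lemma ellipse_form_det:
  assumes "ellipse_with c u v a b E"
  shows "ellipse_form u v a b p p * ellipse_form u v a b (rot90 p) (rot90 p)
    - (ellipse_form u v a b p (rot90 p))\<^sup>2 = (a * b)\<^sup>2 * (p \<bullet> p)\<^sup>2"
proof -
  have "u \<bullet> u = 1" using assms by (auto simp: ellipse_with_def norm_eq_1)
  moreover have "ellipse_form u v a b p p * ellipse_form u v a b (rot90 p) (rot90 p)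
    - (ellipse_form u v a b p (rot90 p))\<^sup>2 = (a * b)\<^sup>2 * (p \<bullet> p)\<^sup>2 * (u \<bullet> u)\<^sup>2"
    unfolding ellipse_form_rot90[OF assms] inner_point rot90_nth by algebra
  ultimately show ?thesis by simp
qed

section \<open>Implicit equation and support function of an ellipse\<close>

text \<open>This is the usual equation in the coordinates along \<open>u\<close> and
  \<open>v\<close>, multiplied by \<open>(a * b)\<^sup>2\<close>. The quarter turn exchanges the two
  coordinates up to sign, so each meets the square of the other semi-axis.\<close>

lemma ellipse_equation:
  assumes E: "ellipse_with c u v a b E"
  shows "x \<in> E \<longleftrightarrow> ellipse_form u v a b (rot90 (x - c)) (rot90 (x - c)) = (a * b)\<^sup>2"
proof -
  have uu: "u \<bullet> u = 1" and vv: "v \<bullet> v = 1" and uv: "u \<bullet> v = 0" and ab: "a > 0" "b > 0"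
    and Eeq: "E = range (ellipse_param c u v a b)"
    using E by (auto simp: ellipse_with_def norm_eq_1)
  have form: "ellipse_form u v a b (rot90 z) (rot90 z) = a\<^sup>2 * (v \<bullet> z)\<^sup>2 + b\<^sup>2 * (u \<bullet> z)\<^sup>2" for z
    unfolding ellipse_form_rot90[OF E]
    using orthonormal_imp_rot90[of u v] E
    by (auto simp: ellipse_with_def inner_point power2_eq_square algebra_simps)
  show ?thesis
  proof
    assume "x \<in> E"
    then obtain t where "x - c = (a * cos t) *\<^sub>R u + (b * sin t) *\<^sub>R v"
      by (auto simp: Eeq ellipse_param_def)
    then have "u \<bullet> (x - c) = a * cos t" "v \<bullet> (x - c) = b * sin t"
      using uu vv uv by (simp_all add: inner_right_distrib inner_commute)
    then have "ellipse_form u v a b (rot90 (x - c)) (rot90 (x - c))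
        = (a * b)\<^sup>2 * ((sin t)\<^sup>2 + (cos t)\<^sup>2)"
      unfolding form by algebra
    then show "ellipse_form u v a b (rot90 (x - c)) (rot90 (x - c)) = (a * b)\<^sup>2" by simp
  next
    assume "ellipse_form u v a b (rot90 (x - c)) (rot90 (x - c)) = (a * b)\<^sup>2"
    then have "a\<^sup>2 * (v \<bullet> (x - c))\<^sup>2 + b\<^sup>2 * (u \<bullet> (x - c))\<^sup>2 = (a * b)\<^sup>2" by (simp add: form)
    then have "((u \<bullet> (x - c)) / a)\<^sup>2 + ((v \<bullet> (x - c)) / b)\<^sup>2 = 1"
      using ab by (simp add: field_simps)
    then obtain t where t: "(u \<bullet> (x - c)) / a = cos t" "(v \<bullet> (x - c)) / b = sin t"
      using sincos_total_2pi by metis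
    have "x - c = (u \<bullet> (x - c)) *\<^sub>R u + (v \<bullet> (x - c)) *\<^sub>R v"
      using rot90_expand[of u "x - c"] uu orthonormal_imp_rot90[of u v] E
      by (auto simp: ellipse_with_def inner_commute)
    also have "u \<bullet> (x - c) = a * cos t" using t ab by (simp add: field_simps)
    also have "v \<bullet> (x - c) = b * sin t" using t ab by (simp add: field_simps)
    finally have "x = ellipse_param c u v a b t"
      by (simp add: ellipse_param_def algebra_simps)
    then show "x \<in> E" by (simp add: Eeq)
  qed
qed

lemma ellipse_param_inner:
  "ellipse_param c u v a b t \<bullet> w = c \<bullet> w + (cos t * (a * (u \<bullet> w)) + sin t * (b * (v \<bullet> w)))"
  by (simp add: ellipse_param_def inner_left_distrib)

text \<open>Cauchy-Schwarz in the plane, through Lagrange's identity.\<close>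

lemma cos_sin_le_sqrt: "cos t * \<alpha> + sin t * \<beta> \<le> sqrt (\<alpha>\<^sup>2 + \<beta>\<^sup>2)"
proof (rule real_le_rsqrt)
  have "\<alpha>\<^sup>2 + \<beta>\<^sup>2 = ((sin t)\<^sup>2 + (cos t)\<^sup>2) * (\<alpha>\<^sup>2 + \<beta>\<^sup>2)" by simp
  also have "\<dots> = (cos t * \<alpha> + sin t * \<beta>)\<^sup>2 + (cos t * \<beta> - sin t * \<alpha>)\<^sup>2" by algebra
  finally show "(cos t * \<alpha> + sin t * \<beta>)\<^sup>2 \<le> \<alpha>\<^sup>2 + \<beta>\<^sup>2" by simp
qed

text \<open>Equality holds when \<open>t\<close> is the polar angle of the vector
  \<open>(\<alpha>, \<beta>)\<close>; for the zero vector every \<open>t\<close> works.\<close>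

lemma cos_sin_eq_sqrt: "\<exists>t. cos t * \<alpha> + sin t * \<beta> = sqrt (\<alpha>\<^sup>2 + \<beta>\<^sup>2)"
proof (cases "\<alpha>\<^sup>2 + \<beta>\<^sup>2 = 0")
  case True
  then show ?thesis by (auto simp: sum_power2_eq_zero_iff)
next
  case False
  define s where "s = sqrt (\<alpha>\<^sup>2 + \<beta>\<^sup>2)"
  have s: "s\<^sup>2 = \<alpha>\<^sup>2 + \<beta>\<^sup>2" "s \<noteq> 0" using False by (auto simp: s_def)
  have "(\<alpha> / s)\<^sup>2 + (\<beta> / s)\<^sup>2 = 1"
    using s(2) by (simp add: power_divide flip: add_divide_distrib s(1))
  then obtain t where "\<alpha> / s = cos t" "\<beta> / s = sin t" using sincos_total_2pi by metis
  then have "cos t * \<alpha> + sin t * \<beta> = (\<alpha>\<^sup>2 + \<beta>\<^sup>2) / s"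
    by (metis add_divide_distrib power2_eq_square times_divide_eq_left)
  also have "\<dots> = s" unfolding s(1)[symmetric] using s(2) by (simp add: power2_eq_square)
  finally show ?thesis by (auto simp: s_def)
qed

lemma ellipse_support:
  assumes E: "ellipse_with c u v a b E"
  shows "x \<in> E \<Longrightarrow> x \<bullet> w \<le> c \<bullet> w + sqrt (ellipse_form u v a b w w)"
    and "\<exists>x\<in>E. x \<bullet> w = c \<bullet> w + sqrt (ellipse_form u v a b w w)"
proof -
  have form: "ellipse_form u v a b w w = (a * (u \<bullet> w))\<^sup>2 + (b * (v \<bullet> w))\<^sup>2"
    by (simp add: ellipse_form_def power2_eq_square)
  have Eeq: "E = range (ellipse_param c u v a b)" using E by (simp add: ellipse_with_def)
  show "x \<bullet> w \<le> c \<bullet> w + sqrt (ellipse_form u v a b w w)" if "x \<in> E"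
    using that cos_sin_le_sqrt by (auto simp: Eeq form ellipse_param_inner)
  obtain t where "cos t * (a * (u \<bullet> w)) + sin t * (b * (v \<bullet> w)) = sqrt (ellipse_form u v a b w w)"
    using cos_sin_eq_sqrt unfolding form by metis
  then have "ellipse_param c u v a b t \<bullet> w = c \<bullet> w + sqrt (ellipse_form u v a b w w)"
    by (simp only: ellipse_param_inner)
  then show "\<exists>x\<in>E. x \<bullet> w = c \<bullet> w + sqrt (ellipse_form u v a b w w)"
    by (auto simp: Eeq)
qed

lemma ellipse_form_nonneg: "0 \<le> ellipse_form u v a b w w"
  by (simp add: ellipse_form_def mult.assoc)

lemma ellipse_form_minus: "ellipse_form u v a b (- w) (- w) = ellipse_form u v a b w w"
  by (simp add: ellipse_form_def)

section \<open>Uniqueness of the semi-axes\<close>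

text \<open>The support function depends on the set \<open>E\<close> alone. Comparing it at
  \<open>w\<close> and \<open>- w\<close> cancels the centres, whose contribution is odd while that
  of the form is even.\<close>

lemma ellipse_form_unique:
  assumes E: "ellipse_with c u v a b E" and E': "ellipse_with c' u' v' a' b' E"
  shows "ellipse_form u v a b w w = ellipse_form u' v' a' b' w w"
proof -
  have *: "c \<bullet> w + sqrt (ellipse_form u v a b w w) = c' \<bullet> w + sqrt (ellipse_form u' v' a' b' w w)" for w
    by (metis antisym ellipse_support[OF E] ellipse_support[OF E'])
  have "sqrt (ellipse_form u v a b w w) = sqrt (ellipse_form u' v' a' b' w w)"
    using *[of w] *[of "- w"] unfolding ellipse_form_minus inner_minus_right by linarith
  then show ?thesis by simp
qed

text \<open>Trace and determinant of the common form give \<open>a\<^sup>2 + b\<^sup>2\<close> and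
  \<open>a * b\<close>, hence \<open>a + b\<close> and \<open>a - b\<close>. This makes the definite
  descriptions of eccentricity and arc length well defined.\<close>

lemma ellipse_semiaxes_unique:
  assumes E: "ellipse_with c u v a b E" and E': "ellipse_with c' u' v' a' b' E"
  shows "a = a' \<and> b = b'"
proof -
  have pos: "0 < b" "b \<le> a" "0 < b'" "b' \<le> a'" and "norm u = 1"
    using E E' by (auto simp: ellipse_with_def)
  then have uu: "u \<bullet> u = 1" by (simp add: norm_eq_1)
  have sum: "a\<^sup>2 + b\<^sup>2 = a'\<^sup>2 + b'\<^sup>2"
    using ellipse_form_trace[OF E, of u] ellipse_form_trace[OF E', of u]
    by (simp add: uu ellipse_form_unique[OF E E'])
  \<comment> \<open>Only diagonal values are known to agree; evaluating at
    \<open>u + rot90 u\<close> recovers the mixed value by polarisation.\<close>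
  have polar: "ellipse_form u v a b u (rot90 u) = ellipse_form u' v' a' b' u (rot90 u)"
    using ellipse_form_bilinear[of u v a b 1 u 1 "rot90 u"]
      ellipse_form_bilinear[of u' v' a' b' 1 u 1 "rot90 u"]
    by (simp add: ellipse_form_unique[OF E E'])
  have "(a * b)\<^sup>2 = (a' * b')\<^sup>2"
    using ellipse_form_det[OF E, of u] ellipse_form_det[OF E', of u]
    by (simp add: uu ellipse_form_unique[OF E E'] polar)
  then have prod: "a * b = a' * b'" using pos by (simp add: power2_eq_iff_nonneg)
  have "(a + b)\<^sup>2 = (a' + b')\<^sup>2" "(a - b)\<^sup>2 = (a' - b')\<^sup>2"
    using sum prod by (simp_all add: power2_sum power2_diff)
  then have "a + b = a' + b'" "a - b = a' - b'"
    using pos by (simp_all add: power2_eq_iff_nonneg)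
  then show ?thesis by simp
qed

section \<open>Eccentricity, area and arc length\<close>

lemma eccentricity_ellipse:
  assumes "ellipse_with c u v a b E"
  shows "eccentricity E = sqrt (1 - b\<^sup>2 / a\<^sup>2)"
  unfolding eccentricity_def
  using assms ellipse_semiaxes_unique[OF assms] by (intro the_equality) blast+

section \<open>Perimeter in terms of the semi-axes\<close>

lemma vector_derivative_ellipse_param:
  "vector_derivative (ellipse_param c u v a b) (at t)
    = (- a * sin t) *\<^sub>R u + (b * cos t) *\<^sub>R v"
proof (rule vector_derivative_at)
  show "(ellipse_param c u v a b has_vector_derivative (- a * sin t) *\<^sub>R u + (b * cos t) *\<^sub>R v) (at t)"
    unfolding ellipse_param_def [abs_def]
    by (auto intro!: derivative_eq_intros simp: mult.commute)
qed

text \<open>A complete elliptic integral of the second kind: the speed of the parametrization over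
  one period.\<close>

definition ellipse_perimeter :: "real \<Rightarrow> real \<Rightarrow> real" where
  "ellipse_perimeter a b = integral {0..2*pi} (\<lambda>t. sqrt (a\<^sup>2 * (sin t)\<^sup>2 + b\<^sup>2 * (cos t)\<^sup>2))"

lemma arc_length_ellipse:
  assumes E: "ellipse_with c u v a b E"
  shows "arc_length E = ellipse_perimeter a b"
proof -
  have len: "curve_length (ellipse_param c u v a b) 0 (2 * pi) = ellipse_perimeter a b"
    if "ellipse_with c u v a b E" for c u v a b
  proof -
    have "norm ((- a * sin t) *\<^sub>R u + (b * cos t) *\<^sub>R v) = sqrt (a\<^sup>2 * (sin t)\<^sup>2 + b\<^sup>2 * (cos t)\<^sup>2)" for t
    proof -
      have "u \<bullet> u = 1" "v \<bullet> v = 1" "u \<bullet> v = 0" "v \<bullet> u = 0"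
        using that by (auto simp: ellipse_with_def norm_eq_1 inner_commute)
      then show ?thesis
        by (simp add: norm_eq_sqrt_inner inner_add power2_eq_square algebra_simps)
    qed
    then show ?thesis
      by (simp add: curve_length_def ellipse_perimeter_def vector_derivative_ellipse_param)
  qed
  show ?thesis
    unfolding arc_length_def using E len ellipse_semiaxes_unique[OF E]
    by (intro the_equality) metis+
qed

text \<open>
  Averaging the integrand over the shift by \<open>pi / 2\<close> makes it pointwise monotone in \<open>a * b\<close>
  when \<open>a\<^sup>2 + b\<^sup>2\<close> is fixed.
\<close>

definition paired_speed :: "real \<Rightarrow> real \<Rightarrow> real \<Rightarrow> real" where
  "paired_speed a b t = sqrt (a\<^sup>2 * (sin t)\<^sup>2 + b\<^sup>2 * (cos t)\<^sup>2) + sqrt (b\<^sup>2 * (sin t)\<^sup>2 + a\<^sup>2 * (cos t)\<^sup>2)"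

text \<open>The shifted interval \<open>{c..T + c}\<close> is cut at \<open>T\<close>, and the part
  beyond \<open>T\<close> is moved back by one period.\<close>

lemma integral_shift_periodic:
  fixes f :: "real \<Rightarrow> real"
  assumes f: "continuous_on UNIV f" and per: "\<And>t. f (t + T) = f t" and "0 \<le> c" "c \<le> T"
  shows "integral {0..T} (\<lambda>t. f (t + c)) = integral {0..T} f"
proof -
  have int: "f integrable_on {x..y}" for x y
    using continuous_on_subset[OF f] by (intro integrable_continuous_real) auto
  have shift: "integral {x..y} (\<lambda>t. f (t + d)) = integral {x+d..y+d} f" for x y d
    using integral_shift_Icc_real[of x y f d] by (simp add: o_def add.commute)
  have "integral {0..T} (\<lambda>t. f (t + c)) = integral {c..T + c} f"
    using shift[of 0 T c] by simp
  also have "\<dots> = integral {c..T} f + integral {0 + T..c + T} f"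
    using Henstock_Kurzweil_Integration.integral_combine[of c T "T + c" f] assms int by (simp add: add.commute)
  also have "integral {0 + T..c + T} f = integral {0..c} f"
    using shift[of 0 c T] per by simp
  also have "integral {c..T} f + integral {0..c} f = integral {0..T} f"
    using Henstock_Kurzweil_Integration.integral_combine[of 0 c T f] assms int by simp
  finally show ?thesis .
qed

text \<open>A shift by \<open>pi / 2\<close> exchanges the squares of sine and cosine, hence
  \<open>a\<close> and \<open>b\<close>, without changing the integral over a period.\<close>

lemma ellipse_perimeter_paired:
  "2 * ellipse_perimeter a b = integral {0..2*pi} (paired_speed a b)"
proof -
  define f where "f = (\<lambda>t. sqrt (a\<^sup>2 * (sin t)\<^sup>2 + b\<^sup>2 * (cos t)\<^sup>2))"
  have cont: "continuous_on UNIV f" unfolding f_def by (intro continuous_intros)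
  have "integral {0..2*pi} (\<lambda>t. f (t + pi/2)) = integral {0..2*pi} f"
    by (rule integral_shift_periodic) (auto simp: f_def intro: cont[unfolded f_def])
  moreover have "f (t + pi/2) = sqrt (b\<^sup>2 * (sin t)\<^sup>2 + a\<^sup>2 * (cos t)\<^sup>2)" for t
    by (simp add: f_def sin_add cos_add add.commute)
  ultimately have "integral {0..2*pi} (\<lambda>t. sqrt (b\<^sup>2 * (sin t)\<^sup>2 + a\<^sup>2 * (cos t)\<^sup>2)) = ellipse_perimeter a b"
    by (simp add: ellipse_perimeter_def f_def)
  moreover have "integral {0..2*pi} (paired_speed a b) = ellipse_perimeter a b
      + integral {0..2*pi} (\<lambda>t. sqrt (b\<^sup>2 * (sin t)\<^sup>2 + a\<^sup>2 * (cos t)\<^sup>2))"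
    unfolding paired_speed_def ellipse_perimeter_def
    by (intro integral_add integrable_continuous_real continuous_intros)
  ultimately show ?thesis by simp
qed

text \<open>The squares of the two speeds add up to a constant in \<open>t\<close>. For fixed
  \<open>a\<^sup>2 + b\<^sup>2\<close>, the semi-axes enter only through
  \<open>(a * b)\<^sup>2\<close>, with a nonnegative coefficient.\<close>

lemma paired_speed_square:
  "(paired_speed a b t)\<^sup>2 = a\<^sup>2 + b\<^sup>2
    + 2 * sqrt ((a * b)\<^sup>2 * ((cos t)\<^sup>2 - (sin t)\<^sup>2)\<^sup>2 + (a\<^sup>2 + b\<^sup>2)\<^sup>2 * (sin t * cos t)\<^sup>2)"
proof -
  define s k where "s = sin t" and "k = cos t"
  have sk: "s\<^sup>2 + k\<^sup>2 = 1" by (simp add: s_def k_def)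
  have "(paired_speed a b t)\<^sup>2 = (a\<^sup>2 * s\<^sup>2 + b\<^sup>2 * k\<^sup>2) + (b\<^sup>2 * s\<^sup>2 + a\<^sup>2 * k\<^sup>2)
      + 2 * sqrt ((a\<^sup>2 * s\<^sup>2 + b\<^sup>2 * k\<^sup>2) * (b\<^sup>2 * s\<^sup>2 + a\<^sup>2 * k\<^sup>2))"
    by (simp add: paired_speed_def power2_sum real_sqrt_mult s_def k_def)
  also have "(a\<^sup>2 * s\<^sup>2 + b\<^sup>2 * k\<^sup>2) + (b\<^sup>2 * s\<^sup>2 + a\<^sup>2 * k\<^sup>2) = (a\<^sup>2 + b\<^sup>2) * (s\<^sup>2 + k\<^sup>2)"
    by algebra
  also have "(a\<^sup>2 * s\<^sup>2 + b\<^sup>2 * k\<^sup>2) * (b\<^sup>2 * s\<^sup>2 + a\<^sup>2 * k\<^sup>2)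
      = (a * b)\<^sup>2 * (k\<^sup>2 - s\<^sup>2)\<^sup>2 + (a\<^sup>2 + b\<^sup>2)\<^sup>2 * (s * k)\<^sup>2"
    by algebra
  finally show ?thesis by (simp add: s_def k_def)
qed

lemma ellipse_perimeter_less:
  assumes pos: "0 < a" "0 < b" "0 < a'" "0 < b'"
    and sum: "a\<^sup>2 + b\<^sup>2 = a'\<^sup>2 + b'\<^sup>2" and less: "a * b < a' * b'"
  shows "ellipse_perimeter a b < ellipse_perimeter a' b'"
proof -
  have nonneg: "0 \<le> paired_speed a b t" for a b t by (simp add: paired_speed_def)
  have prod: "(a * b)\<^sup>2 \<le> (a' * b')\<^sup>2" using less pos by (intro power_mono) auto
  have le: "paired_speed a b t \<le> paired_speed a' b' t" for t
  proof (rule power2_le_imp_le[OF _ nonneg])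
    show "(paired_speed a b t)\<^sup>2 \<le> (paired_speed a' b' t)\<^sup>2"
      unfolding paired_speed_square sum
      using prod by (intro add_left_mono mult_left_mono) (auto intro!: mult_right_mono)
  qed
  have "(a + b)\<^sup>2 < (a' + b')\<^sup>2" using sum less by (simp add: power2_sum)
  then have "a + b < a' + b'" by (rule power2_less_imp_less) (use pos in simp)
  \<comment> \<open>At \<open>t = 0\<close> the paired speed equals \<open>a + b\<close>, so the
    pointwise inequality is strict there.\<close>
  then have strict: "paired_speed a' b' 0 - paired_speed a b 0 \<noteq> 0"
    using pos by (simp add: paired_speed_def)
  have cont: "continuous_on S (paired_speed a b)" for a b S
    unfolding paired_speed_def by (intro continuous_intros)
  \<comment> \<open>A continuous nonnegative function has integral zero only if it vanishes on the
    whole interval, which fails at \<open>0\<close>.\<close>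
  have "integral {0..2*pi} (\<lambda>t. paired_speed a' b' t - paired_speed a b t) \<noteq> 0"
    using strict le by (subst integral_eq_0_iff) (auto intro!: continuous_intros cont intro: bexI[of _ 0])
  moreover have "integral {0..2*pi} (\<lambda>t. paired_speed a' b' t - paired_speed a b t) \<ge> 0"
    using le by (intro integral_nonneg integrable_continuous_real continuous_intros cont) auto
  moreover have "integral {0..2*pi} (\<lambda>t. paired_speed a' b' t - paired_speed a b t)
      = integral {0..2*pi} (paired_speed a' b') - integral {0..2*pi} (paired_speed a b)"
    by (intro integral_diff integrable_continuous_real cont)
  ultimately show ?thesis
    using ellipse_perimeter_paired[of a b] ellipse_perimeter_paired[of a' b'] by linarith
qed

section \<open>Area of an ellipse\<close>

lemma range_cos_sin: "range (\<lambda>t. vector [cos t, sin t] :: point) = sphere 0 1"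
proof -
  have "x \<in> sphere 0 1 \<longleftrightarrow> (x$1)\<^sup>2 + (x$2)\<^sup>2 = 1" for x :: point
    by (simp add: norm_eq_sqrt_inner inner_point power2_eq_square)
  then show ?thesis
    by (auto simp: point_eq_iff image_iff) (metis sincos_total_2pi)
qed

text \<open>The enclosed region is the image of the open unit disc under \<open>L\<close> followed
  by a translation, so the area of the disc is scaled by the absolute determinant of
  \<open>L\<close>.\<close>

lemma ellipse_area_ellipse:
  assumes E: "ellipse_with c u v a b E"
  shows "ellipse_area E = a * b * pi"
proof -
  define L where "L = (\<lambda>x::point. (a * x$1) *\<^sub>R u + (b * x$2) *\<^sub>R v)"
  have pos: "0 < a" "0 < b" and v: "v = rot90 u \<or> v = - rot90 u" and uu: "u$1 * u$1 + u$2 * u$2 = 1"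
    using E orthonormal_imp_rot90[of u v] by (auto simp: ellipse_with_def norm_eq_1 inner_point)
  have lin: "linear L"
    unfolding L_def by (rule linearI) (simp_all add: algebra_simps)
  have entries: "matrix L $ 1 $ 1 = a * u$1" "matrix L $ 2 $ 1 = a * u$2"
      "matrix L $ 1 $ 2 = b * v$1" "matrix L $ 2 $ 2 = b * v$2"
    by (simp_all add: matrix_def L_def axis_def)
  have "det (matrix L) = a * b * (u$1 * v$2 - u$2 * v$1)"
    unfolding det_2 entries by algebra
  \<comment> \<open>The sign is the orientation of the orthonormal pair \<open>u\<close>,
    \<open>v\<close>.\<close>
  moreover have "u$1 * v$2 - u$2 * v$1 = 1 \<or> u$1 * v$2 - u$2 * v$1 = - 1"
    using v uu by auto
  ultimately have det: "\<bar>det (matrix L)\<bar> = a * b"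
    using pos by auto
  then have inj: "inj L"
    using lin pos by (metis abs_zero det_nz_iff_inj mult_pos_pos order_less_irrefl)
  have bl: "bounded_linear L" using lin by (simp add: linear_conv_bounded_linear)
  have "E = (+) c ` L ` sphere 0 1"
    using E unfolding ellipse_with_def
    by (simp add: range_cos_sin[symmetric] image_image ellipse_param_def[abs_def] L_def add.assoc)
  \<comment> \<open>The circle is the frontier of the disc, and an injective linear map commutes
    with closure and interior. For a bounded convex set the inside of the frontier is then the
    interior.\<close>
  also have "L ` sphere 0 1 = frontier (L ` cball 0 1)"
    using closure_injective_linear_image[OF lin inj, of "cball 0 1"]
      interior_injective_linear_image[OF lin inj, of "cball 0 1"]
    by (simp add: frontier_def image_set_diff[OF inj] cball_diff_eq_sphere flip: image_set_diff[OF inj])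
  finally have "E = frontier ((+) c ` L ` cball 0 1)"
    by (simp add: frontier_translation)
  moreover have "bounded ((+) c ` L ` cball 0 1)"
    by (intro bounded_translation bounded_linear_image[OF _ bl]) simp
  moreover have "convex ((+) c ` L ` cball 0 1)"
    by (intro convex_translation convex_linear_image[OF lin]) simp
  ultimately have "inside E = interior ((+) c ` L ` cball 0 1)"
    by (simp add: inside_frontier_eq_interior)
  also have "\<dots> = (+) c ` L ` ball 0 1"
    by (simp add: interior_translation interior_injective_linear_image[OF lin inj])
  finally have "ellipse_area E = measure lebesgue (L ` ball 0 1)"
    by (simp add: ellipse_area_def measure_translation)
  also have "\<dots> = a * b * measure lebesgue (ball (0::point) 1)"
    using measure_linear_image[OF lin, of "ball 0 1"] det by simp
  also have "measure lebesgue (ball (0::point) 1) = pi"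
    using content_ball[of 1 "0::point"] by (simp add: unit_ball_vol_2)
  finally show ?thesis .
qed


section \<open>Comparison of eccentricities\<close>

text \<open>With the sum of squares fixed, a larger product increases \<open>a + b\<close> and
  decreases \<open>a - b\<close>. So the minor semi-axis grows, the major one cannot grow, and their
  ratio increases.\<close>

lemma eccentricity_less:
  fixes a b a' b' :: real
  assumes pos: "0 < b" "b \<le> a" "0 < b'" "b' \<le> a'"
    and sum: "a\<^sup>2 + b\<^sup>2 = a'\<^sup>2 + b'\<^sup>2" and less: "a * b < a' * b'"
  shows "sqrt (1 - b'\<^sup>2 / a'\<^sup>2) < sqrt (1 - b\<^sup>2 / a\<^sup>2)"
proof -
  have "(a' - b')\<^sup>2 < (a - b)\<^sup>2" using sum less by (simp add: power2_diff)
  then have diff: "a' - b' < a - b" by (rule power2_less_imp_less) (use pos in simp)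
  have "(a + b)\<^sup>2 < (a' + b')\<^sup>2" using sum less by (simp add: power2_sum)
  then have "a + b < a' + b'" by (rule power2_less_imp_less) (use pos in simp)
  with diff have "b < b'" by linarith
  then have "b\<^sup>2 < b'\<^sup>2" using pos by (intro power_strict_mono) auto
  moreover from this have "a'\<^sup>2 \<le> a\<^sup>2" using sum by linarith
  ultimately have "b\<^sup>2 / a\<^sup>2 < b'\<^sup>2 / a'\<^sup>2"
    using pos by (intro frac_less) simp_all
  then show ?thesis by simp
qed

section \<open>Inscribed ellipses\<close>

lemma rectangle_rotate: "rectangle A B C D \<Longrightarrow> rectangle B C D A"
proof -
  assume r: "rectangle A B C D"
  then have "C - B = D - A" "A - B = - (B - A)" "D - C = A - B"
    by (auto simp: rectangle_def algebra_simps)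
  then show "rectangle B C D A"
    using r unfolding rectangle_def by (metis eq_iff_diff_eq_0 inner_commute inner_minus_right neg_equal_0_iff_equal)
qed

lemma midpoint_ellipse_rotate: "midpoint_ellipse B C D A E \<longleftrightarrow> midpoint_ellipse A B C D E"
  unfolding midpoint_ellipse_def inscribed_def rectangle_region_def
  by (auto simp: insert_commute)

lemma tangent_to_side_at_imp_mem: "tangent_to_side_at E P Q x \<Longrightarrow> x \<in> E \<and> x \<in> closed_segment P Q"
  by (auto simp: tangent_to_side_at_def tangent_line_def ellipse_with_def)

lemma closed_segment_inner:
  assumes "x \<in> closed_segment P Q" "(P - A) \<bullet> w = k" "(Q - A) \<bullet> w = k"
  shows "(x - A) \<bullet> w = k"
proof -
  obtain s where x: "x = (1 - s) *\<^sub>R P + s *\<^sub>R Q" using assms(1) by (auto simp: in_segment)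
  have "(x - A) \<bullet> w = (1 - s) * ((P - A) \<bullet> w) + s * ((Q - A) \<bullet> w)"
    unfolding x by (simp add: inner_diff_left inner_add_left algebra_simps)
  then show ?thesis using assms by (simp add: algebra_simps)
qed

text \<open>Touching both boundary lines of the strip fixes the support values in the directions
  \<open>w\<close> and \<open>- w\<close>; their sum and difference give the form and the
  centre.\<close>

lemma ellipse_in_strip:
  assumes E: "ellipse_with c u v a b E"
    and strip: "\<And>x. x \<in> E \<Longrightarrow> 0 \<le> (x - A) \<bullet> w \<and> (x - A) \<bullet> w \<le> w \<bullet> w"
    and x: "x \<in> E" "(x - A) \<bullet> w = 0" and y: "y \<in> E" "(y - A) \<bullet> w = w \<bullet> w"
  shows "(c - A) \<bullet> w = w \<bullet> w / 2" "ellipse_form u v a b w w = (w \<bullet> w)\<^sup>2 / 4"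
proof -
  define S where "S = sqrt (ellipse_form u v a b w w)"
  have upper: "z \<bullet> w \<le> c \<bullet> w + S" "- (z \<bullet> w) \<le> - (c \<bullet> w) + S" if "z \<in> E" for z
    using ellipse_support(1)[OF E that, of w] ellipse_support(1)[OF E that, of "- w"]
    by (simp_all add: S_def ellipse_form_minus)
  obtain z where z: "z \<in> E" "z \<bullet> w = c \<bullet> w + S"
    using ellipse_support(2)[OF E, of w] by (auto simp: S_def)
  obtain z' where z': "z' \<in> E" "- (z' \<bullet> w) = - (c \<bullet> w) + S"
    using ellipse_support(2)[OF E, of "- w"] by (auto simp: S_def ellipse_form_minus)
  have "c \<bullet> w - A \<bullet> w + S = w \<bullet> w"
    using strip[OF z(1)] z(2) upper(1)[OF y(1)] y(2) by (simp add: inner_diff_left)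
  moreover have "c \<bullet> w - A \<bullet> w - S = 0"
    using strip[OF z'(1)] z'(2) upper(2)[OF x(1)] x(2) by (simp add: inner_diff_left)
  ultimately have "(c - A) \<bullet> w = w \<bullet> w / 2" and S: "S = w \<bullet> w / 2"
    by (simp_all add: inner_diff_left)
  then show "(c - A) \<bullet> w = w \<bullet> w / 2" by simp
  have "ellipse_form u v a b w w = S\<^sup>2"
    by (simp add: S_def ellipse_form_nonneg)
  then show "ellipse_form u v a b w w = (w \<bullet> w)\<^sup>2 / 4"
    by (simp add: S power_divide)
qed

lemma rectangle_region_strip:
  assumes "rectangle A B C D" "x \<in> rectangle_region A B C D" "w = B - A \<or> w = D - A"
  shows "0 \<le> (x - A) \<bullet> w \<and> (x - A) \<bullet> w \<le> w \<bullet> w"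
proof -
  define T where "T = {x. A \<bullet> w \<le> w \<bullet> x} \<inter> {x. w \<bullet> x \<le> A \<bullet> w + w \<bullet> w}"
  have C: "C = B + D - A" and perp: "(B - A) \<bullet> (D - A) = 0"
    using assms(1) by (auto simp: rectangle_def algebra_simps)
  have T: "y \<in> T \<longleftrightarrow> 0 \<le> (y - A) \<bullet> w \<and> (y - A) \<bullet> w \<le> w \<bullet> w" for y
    by (auto simp: T_def inner_diff_left inner_commute[of w y])
  have "(C - A) \<bullet> w = (B - A) \<bullet> w + (D - A) \<bullet> w"
    unfolding C inner_diff_left inner_add_left by simp
  \<comment> \<open>Either choice of \<open>w\<close> is orthogonal to the other side, so
    \<open>C\<close> gets a contribution from one side only and stays in the strip.\<close>
  moreover have "(B - A) \<bullet> w \<in> {0, w \<bullet> w}" "(D - A) \<bullet> w \<in> {0, w \<bullet> w}"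
      "(B - A) \<bullet> w = 0 \<or> (D - A) \<bullet> w = 0"
    using assms(3) perp by (auto simp: inner_commute)
  ultimately have "{A, B, C, D} \<subseteq> T" by (auto simp: T)
  moreover have "convex T"
    unfolding T_def by (intro convex_Int convex_halfspace_ge convex_halfspace_le)
  ultimately have "rectangle_region A B C D \<subseteq> T"
    unfolding rectangle_region_def by (rule hull_minimal)
  then show ?thesis using assms(2) T by blast
qed

text \<open>One parametrized inscribed ellipse with named sides; two instances over the same
  rectangle are compared later.\<close>

locale inscribed_ellipse =
  fixes A B C D c u v :: point and a b :: real and E :: "point set" and p q :: point
  assumes rect: "rectangle A B C D" and ins: "inscribed A B C D E"
    and ell: "ellipse_with c u v a b E"
    and p_def: "p = B - A" and q_def: "q = D - A"
begin

lemma vertices: "B = A + p" "D = A + q" "C = A + p + q"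
  using rect by (auto simp: p_def q_def rectangle_def algebra_simps)

lemma sides: "p \<noteq> 0" "q \<noteq> 0" "p \<bullet> q = 0"
  using rect by (auto simp: p_def q_def rectangle_def)

lemma strip:
  assumes "x \<in> E" "w = p \<or> w = q"
  shows "0 \<le> (x - A) \<bullet> w \<and> (x - A) \<bullet> w \<le> w \<bullet> w"
  using rectangle_region_strip[OF rect, of x w] assms ins
  by (auto simp: inscribed_def p_def q_def)

text \<open>\<open>D A\<close> and \<open>B C\<close> lie on the boundary lines of the strip in
  direction \<open>p\<close>, \<open>A B\<close> and \<open>C D\<close> on those in direction
  \<open>q\<close>. The contact points therefore meet the conditions of
  \<open>ellipse_in_strip\<close>.\<close>

lemma support:
  "(c - A) \<bullet> p = p \<bullet> p / 2" "ellipse_form u v a b p p = (p \<bullet> p)\<^sup>2 / 4"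
  "(c - A) \<bullet> q = q \<bullet> q / 2" "ellipse_form u v a b q q = (q \<bullet> q)\<^sup>2 / 4"
proof -
  have touch: "\<exists>x\<in>E. (x - A) \<bullet> w = k"
    if side: "tangent_to_side E P Q" and ends: "(P - A) \<bullet> w = k" "(Q - A) \<bullet> w = k" for P Q w k
  proof -
    obtain x where "tangent_to_side_at E P Q x" using side by (auto simp: tangent_to_side_def)
    then show ?thesis
      using closed_segment_inner ends by (blast dest: tangent_to_side_at_imp_mem)
  qed
  have tan: "tangent_to_side E A B" "tangent_to_side E B C" "tangent_to_side E C D" "tangent_to_side E D A"
    using ins by (auto simp: inscribed_def)
  have diffs: "A - A = 0" "B - A = p" "C - A = p + q" "D - A = q" and "q \<bullet> p = 0"
    using sides(3) by (simp_all add: vertices inner_commute)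
  note inners = diffs \<open>q \<bullet> p = 0\<close> sides(3) inner_add_left
  obtain w where w: "w \<in> E" "(w - A) \<bullet> q = 0"
    using touch[OF tan(1), of q 0] by (auto simp: inners)
  obtain x where x: "x \<in> E" "(x - A) \<bullet> p = p \<bullet> p"
    using touch[OF tan(2), of p "p \<bullet> p"] by (auto simp: inners)
  obtain y where y: "y \<in> E" "(y - A) \<bullet> q = q \<bullet> q"
    using touch[OF tan(3), of q "q \<bullet> q"] by (auto simp: inners)
  obtain z where z: "z \<in> E" "(z - A) \<bullet> p = 0"
    using touch[OF tan(4), of p 0] by (auto simp: inners)
  show "(c - A) \<bullet> p = p \<bullet> p / 2" "ellipse_form u v a b p p = (p \<bullet> p)\<^sup>2 / 4"
    by (rule ellipse_in_strip[OF ell _ z x], simp add: strip)+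
  show "(c - A) \<bullet> q = q \<bullet> q / 2" "ellipse_form u v a b q q = (q \<bullet> q)\<^sup>2 / 4"
    by (rule ellipse_in_strip[OF ell _ w y], simp add: strip)+
qed

text \<open>Rescales the known value on \<open>q\<close> to one on \<open>rot90 p\<close>, the
  second diagonal entry of the form in the basis \<open>p\<close>, \<open>rot90 p\<close>.\<close>

lemma rot90_side:
  obtains \<tau> where "\<tau> \<noteq> 0" "q = \<tau> *\<^sub>R rot90 p" "q \<bullet> q = \<tau>\<^sup>2 * (p \<bullet> p)"
    "ellipse_form u v a b (rot90 p) (rot90 p) = \<tau>\<^sup>2 * (p \<bullet> p)\<^sup>2 / 4"
proof -
  obtain \<tau> where \<tau>: "q = \<tau> *\<^sub>R rot90 p"
    using orthogonal_imp_scaled_rot90 sides by blast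
  then have "\<tau> \<noteq> 0" using sides by auto
  have qq: "q \<bullet> q = \<tau>\<^sup>2 * (p \<bullet> p)" by (simp add: \<tau> power2_eq_square)
  have "\<tau>\<^sup>2 * ellipse_form u v a b (rot90 p) (rot90 p) = \<tau>\<^sup>2 * (\<tau>\<^sup>2 * (p \<bullet> p)\<^sup>2 / 4)"
    using support(4) unfolding qq by (simp add: \<tau> ellipse_form_scale power2_eq_square mult_ac)
  then have "ellipse_form u v a b (rot90 p) (rot90 p) = \<tau>\<^sup>2 * (p \<bullet> p)\<^sup>2 / 4"
    using \<open>\<tau> \<noteq> 0\<close> by (metis mult_cancel_left power_eq_0_iff)
  with \<open>\<tau> \<noteq> 0\<close> \<tau> qq show ?thesis by (rule that)
qed

lemma centre: "c = A + (1/2) *\<^sub>R (p + q)"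
proof -
  define z where "z = c - (A + (1/2) *\<^sub>R (p + q))"
  obtain \<tau> where \<tau>: "\<tau> \<noteq> 0" "q = \<tau> *\<^sub>R rot90 p" by (rule rot90_side)
  have "z \<bullet> p = 0" "z \<bullet> q = 0"
    using support(1,3) sides(3)
    by (simp_all add: z_def inner_diff_left inner_add_left inner_commute algebra_simps)
  then have "(p \<bullet> p) *\<^sub>R z = 0" using rot90_expand[of p z] \<tau> by simp
  then show ?thesis using sides by (simp add: z_def)
qed

text \<open>The trace, from the two known diagonal entries. Geometrically, the vertices lie on the
  director circle, of radius \<open>sqrt (a\<^sup>2 + b\<^sup>2)\<close>.\<close>

lemma semiaxes_sum: "4 * (a\<^sup>2 + b\<^sup>2) = p \<bullet> p + q \<bullet> q"
proof -
  obtain \<tau> where \<tau>: "q \<bullet> q = \<tau>\<^sup>2 * (p \<bullet> p)"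
    "ellipse_form u v a b (rot90 p) (rot90 p) = \<tau>\<^sup>2 * (p \<bullet> p)\<^sup>2 / 4" by (rule rot90_side)
  have "(p \<bullet> p) * (4 * (a\<^sup>2 + b\<^sup>2)) = (p \<bullet> p) * (p \<bullet> p + q \<bullet> q)"
    using ellipse_form_trace[OF ell, of p] unfolding \<tau> support(2)
    by (simp add: power2_eq_square algebra_simps)
  then show ?thesis using sides by simp
qed

text \<open>The determinant, with the off-diagonal entry as the only unknown besides
  \<open>a * b\<close>.\<close>

lemma semiaxes_prod:
  "16 * (a * b)\<^sup>2 * (p \<bullet> p)\<^sup>2 + 16 * (ellipse_form u v a b p (rot90 p))\<^sup>2 = (p \<bullet> p) * (q \<bullet> q) * (p \<bullet> p)\<^sup>2"
proof -
  obtain \<tau> where \<tau>: "q \<bullet> q = \<tau>\<^sup>2 * (p \<bullet> p)"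
    "ellipse_form u v a b (rot90 p) (rot90 p) = \<tau>\<^sup>2 * (p \<bullet> p)\<^sup>2 / 4" by (rule rot90_side)
  show ?thesis
    using ellipse_form_det[OF ell, of p] unfolding \<tau> support(2)
    by (simp add: power2_eq_square algebra_simps)
qed

lemma semiaxes_prod_le: "16 * (a * b)\<^sup>2 \<le> (p \<bullet> p) * (q \<bullet> q)"
proof -
  have "16 * (a * b)\<^sup>2 * (p \<bullet> p)\<^sup>2 \<le> (p \<bullet> p) * (q \<bullet> q) * (p \<bullet> p)\<^sup>2"
    using semiaxes_prod zero_le_power2[of "ellipse_form u v a b p (rot90 p)"] by linarith
  then show ?thesis using sides by (simp add: mult_le_cancel_right)
qed

text \<open>Equality forces the off-diagonal entry to vanish, so the form is diagonal and known. The
  resulting equation contains only data of the rectangle, hence extremal inscribed ellipses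
  coincide.\<close>

lemma extremal_equation:
  assumes ext: "16 * (a * b)\<^sup>2 = (p \<bullet> p) * (q \<bullet> q)"
  shows "x \<in> E \<longleftrightarrow> 4 * ((rot90 (x - (A + (1/2) *\<^sub>R (p + q))) \<bullet> p)\<^sup>2
    + (rot90 (x - (A + (1/2) *\<^sub>R (p + q))) \<bullet> q)\<^sup>2) = (p \<bullet> p) * (q \<bullet> q)"
proof -
  obtain \<tau> where \<tau>: "q = \<tau> *\<^sub>R rot90 p"
    "ellipse_form u v a b (rot90 p) (rot90 p) = \<tau>\<^sup>2 * (p \<bullet> p)\<^sup>2 / 4" by (rule rot90_side)
  have orth: "ellipse_form u v a b p (rot90 p) = 0"
    using semiaxes_prod unfolding ext by simp
  have form: "4 * ellipse_form u v a b z z = (z \<bullet> p)\<^sup>2 + (z \<bullet> q)\<^sup>2" for z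
  proof -
    have "(p \<bullet> p)\<^sup>2 * ellipse_form u v a b z z
        = ellipse_form u v a b ((p \<bullet> p) *\<^sub>R z) ((p \<bullet> p) *\<^sub>R z)"
      by (simp add: ellipse_form_scale)
    also have "\<dots> = (z \<bullet> p)\<^sup>2 * (p \<bullet> p)\<^sup>2 / 4 + (z \<bullet> rot90 p)\<^sup>2 * (\<tau>\<^sup>2 * (p \<bullet> p)\<^sup>2 / 4)"
      unfolding rot90_expand ellipse_form_bilinear orth \<tau>(2) support(2) by simp
    finally have "(p \<bullet> p)\<^sup>2 * (4 * ellipse_form u v a b z z) = (p \<bullet> p)\<^sup>2 * ((z \<bullet> p)\<^sup>2 + (z \<bullet> q)\<^sup>2)"
      by (simp add: \<tau>(1) power_mult_distrib algebra_simps)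
    then show ?thesis using sides by simp
  qed
  show ?thesis
    unfolding ellipse_equation[OF ell] centre[symmetric] form[symmetric] ext[symmetric] by simp
qed

text \<open>The vector from the centre to this midpoint is half of \<open>p\<close>. The equation of
  \<open>E\<close> there evaluates the form on a multiple of \<open>rot90 p\<close>, where it is
  prescribed, and this yields \<open>a * b\<close>.\<close>

lemma midpoint_imp_extremal:
  assumes "midpoint B C \<in> E"
  shows "16 * (a * b)\<^sup>2 = (p \<bullet> p) * (q \<bullet> q)"
proof -
  obtain \<tau> where \<tau>: "q \<bullet> q = \<tau>\<^sup>2 * (p \<bullet> p)"
    "ellipse_form u v a b (rot90 p) (rot90 p) = \<tau>\<^sup>2 * (p \<bullet> p)\<^sup>2 / 4" by (rule rot90_side)
  have "midpoint B C - c = (1/2) *\<^sub>R p"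
    by (simp add: centre vertices midpoint_def point_eq_iff field_simps)
  moreover have "rot90 ((1/2) *\<^sub>R p) = (1/2) *\<^sub>R rot90 p"
    by (simp add: point_eq_iff)
  ultimately have "(a * b)\<^sup>2 = (1/2)\<^sup>2 * (\<tau>\<^sup>2 * (p \<bullet> p)\<^sup>2 / 4)"
    using assms unfolding ellipse_equation[OF ell] by (simp only: ellipse_form_scale \<tau>)
  then show ?thesis by (simp add: \<tau> power2_eq_square mult_ac)
qed

end

section \<open>Existence of the midpoint ellipse\<close>

text \<open>The tangent and the side line are matched by the substitution
  \<open>r = 1/2 + s * k\<close>, invertible because \<open>k\<close> is nonzero.\<close>

lemma tangent_to_side_at_midpoint:
  assumes E: "ellipse_with c u v a b E"
    and x: "ellipse_param c u v a b t = midpoint P Q"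
    and d: "vector_derivative (ellipse_param c u v a b) (at t) = k *\<^sub>R (Q - P)" and "k \<noteq> 0"
  shows "tangent_to_side_at E P Q (midpoint P Q)"
proof -
  have mid: "midpoint P Q = P + (1/2) *\<^sub>R (Q - P)"
    unfolding midpoint_def point_eq_iff by (simp add: field_simps)
  have "range (\<lambda>s. midpoint P Q + s *\<^sub>R k *\<^sub>R (Q - P)) = range (\<lambda>r. P + r *\<^sub>R (Q - P))"
  proof (intro equalityI subsetI; elim rangeE; hypsubst)
    fix s
    have "midpoint P Q + s *\<^sub>R k *\<^sub>R (Q - P) = P + (1/2 + s * k) *\<^sub>R (Q - P)"
      unfolding mid scaleR_scaleR add.assoc scaleR_left_distrib ..
    then show "midpoint P Q + s *\<^sub>R k *\<^sub>R (Q - P) \<in> range (\<lambda>r. P + r *\<^sub>R (Q - P))"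
      by (rule range_eqI)
  next
    fix r
    have "P + r *\<^sub>R (Q - P) = midpoint P Q + ((r - 1/2) / k) *\<^sub>R k *\<^sub>R (Q - P)"
      using \<open>k \<noteq> 0\<close> unfolding mid scaleR_scaleR add.assoc scaleR_left_distrib[symmetric] by simp
    then show "P + r *\<^sub>R (Q - P) \<in> range (\<lambda>s. midpoint P Q + s *\<^sub>R k *\<^sub>R (Q - P))"
      by (rule range_eqI)
  qed
  then have "tangent_line E (midpoint P Q) (affine hull {P, Q})"
    unfolding tangent_line_def affine_hull_2_alt using E x d by metis
  then show ?thesis by (simp add: tangent_to_side_at_def)
qed

lemma parallelogram_mem:
  assumes "0 \<le> \<alpha>" "\<alpha> \<le> 1" "0 \<le> \<beta>" "\<beta> \<le> 1" "C = B + D - A"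
  shows "A + \<alpha> *\<^sub>R (B - A) + \<beta> *\<^sub>R (D - A) \<in> rectangle_region A B C D"
proof -
  let ?H = "convex hull {A, B, C, D}"
  have mem: "A \<in> ?H" "B \<in> ?H" "C \<in> ?H" "D \<in> ?H" by (auto intro: hull_inc)
  have conv: "(1 - s) *\<^sub>R y + s *\<^sub>R z \<in> ?H" if "y \<in> ?H" "z \<in> ?H" "0 \<le> s" "s \<le> 1" for y z s
    using that by (intro convexD_alt) auto
  have "(1 - \<beta>) *\<^sub>R ((1 - \<alpha>) *\<^sub>R A + \<alpha> *\<^sub>R B) + \<beta> *\<^sub>R ((1 - \<alpha>) *\<^sub>R D + \<alpha> *\<^sub>R C) \<in> ?H"
    using assms mem by (intro conv) auto
  also have "(1 - \<beta>) *\<^sub>R ((1 - \<alpha>) *\<^sub>R A + \<alpha> *\<^sub>R B) + \<beta> *\<^sub>R ((1 - \<alpha>) *\<^sub>R D + \<alpha> *\<^sub>R C)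
      = A + \<alpha> *\<^sub>R (B - A) + \<beta> *\<^sub>R (D - A)"
    by (simp add: assms(5) point_eq_iff algebra_simps)
  finally show ?thesis by (simp add: rectangle_region_def)
qed

text \<open>The witness has axes parallel to the sides and half their lengths as semi-axes;
  \<open>le\<close> ensures that \<open>a\<close> is the major one.\<close>

lemma midpoint_ellipse_exists_long:
  assumes rect: "rectangle A B C D" and le: "norm (D - A) \<le> norm (B - A)"
  shows "\<exists>E. midpoint_ellipse A B C D E"
proof -
  define p q where "p = B - A" and "q = D - A"
  have pq: "p \<noteq> 0" "q \<noteq> 0" "p \<bullet> q = 0" and C: "C = B + D - A"
    using rect by (auto simp: p_def q_def rectangle_def algebra_simps)
  have B: "B = A + p" and D: "D = A + q" by (simp_all add: p_def q_def)
  define c u v a b where "c = midpoint A C" and "u = p /\<^sub>R norm p" and "v = q /\<^sub>R norm q"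
    and "a = norm p / 2" and "b = norm q / 2"
  define E where "E = range (ellipse_param c u v a b)"
  have E: "ellipse_with c u v a b E"
    using pq le by (simp add: ellipse_with_def E_def u_def v_def a_def b_def p_def q_def)
  have param: "ellipse_param c u v a b t = A + ((1 + cos t) / 2) *\<^sub>R p + ((1 + sin t) / 2) *\<^sub>R q" for t
    using pq by (simp add: ellipse_param_def c_def u_def v_def a_def b_def C B D midpoint_def
        point_eq_iff field_simps)
  have deriv: "vector_derivative (ellipse_param c u v a b) (at t)
      = (- sin t / 2) *\<^sub>R p + (cos t / 2) *\<^sub>R q" for t
    using pq by (simp add: vector_derivative_ellipse_param u_def v_def a_def b_def field_simps)
  have bounds: "0 \<le> (1 + x) / 2" "(1 + x) / 2 \<le> 1" if "\<bar>x\<bar> \<le> 1" for x :: real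
    using that by auto
  have "E \<subseteq> rectangle_region A B C D"
    unfolding E_def
  proof (rule image_subsetI)
    fix t
    show "ellipse_param c u v a b t \<in> rectangle_region A B C D"
      unfolding param p_def q_def by (intro parallelogram_mem bounds) (auto simp: C)
  qed
  \<comment> \<open>The midpoints occur at quarter-period steps starting from
    \<open>- (pi/2)\<close>, and the velocity at each is half the side vector in cyclic order,
    whence \<open>k = 1/2\<close>.\<close>
  moreover have "tangent_to_side_at E A B (midpoint A B)"
    by (rule tangent_to_side_at_midpoint[OF E, where t = "- (pi/2)" and k = "1/2"], use pq in
        \<open>simp_all add: param deriv B C D midpoint_def point_eq_iff field_simps\<close>)
  moreover have "tangent_to_side_at E B C (midpoint B C)"
    by (rule tangent_to_side_at_midpoint[OF E, where t = 0 and k = "1/2"], use pq in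
        \<open>simp_all add: param deriv B C D midpoint_def point_eq_iff field_simps\<close>)
  moreover have "tangent_to_side_at E C D (midpoint C D)"
    by (rule tangent_to_side_at_midpoint[OF E, where t = "pi/2" and k = "1/2"], use pq in
        \<open>simp_all add: param deriv B C D midpoint_def point_eq_iff field_simps\<close>)
  moreover have "tangent_to_side_at E D A (midpoint D A)"
    by (rule tangent_to_side_at_midpoint[OF E, where t = pi and k = "1/2"], use pq in
        \<open>simp_all add: param deriv B C D midpoint_def point_eq_iff field_simps\<close>)
  ultimately have "midpoint_ellipse A B C D E"
    using E unfolding midpoint_ellipse_def inscribed_def is_ellipse_def tangent_to_side_def by blast
  then show ?thesis ..
qed

lemma midpoint_ellipse_exists:
  assumes rect: "rectangle A B C D"
  shows "\<exists>E. midpoint_ellipse A B C D E"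
proof (cases "norm (D - A) \<le> norm (B - A)")
  case True
  then show ?thesis using midpoint_ellipse_exists_long rect by blast
next
  case False
  have "C - B = D - A" using rect by (auto simp: rectangle_def algebra_simps)
  \<comment> \<open>Relabelling the vertices cyclically puts the longer side first.\<close>
  then have "norm (A - B) \<le> norm (C - B)" using False by (simp add: norm_minus_commute)
  then show ?thesis
    using midpoint_ellipse_exists_long rectangle_rotate[OF rect] midpoint_ellipse_rotate by blast
qed

section \<open>Comparison with the midpoint ellipse\<close>

text \<open>The midpoint ellipse attains the upper bound for the product. An ellipse attaining it
  too would satisfy the same equation and so equal \<open>M\<close>.\<close>

lemma inscribed_eq_or_less:
  assumes rect: "rectangle A B C D" and M: "midpoint_ellipse A B C D M"
    and E: "inscribed A B C D E" "ellipse_with c u v a b E"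
    and M': "ellipse_with c' u' v' a' b' M" and neq: "E \<noteq> M"
  shows "a\<^sup>2 + b\<^sup>2 = a'\<^sup>2 + b'\<^sup>2" "a * b < a' * b'"
proof -
  interpret E: inscribed_ellipse A B C D c u v a b E "B - A" "D - A"
    using assms by unfold_locales auto
  interpret M: inscribed_ellipse A B C D c' u' v' a' b' M "B - A" "D - A"
    using assms by unfold_locales (auto simp: midpoint_ellipse_def)
  show "a\<^sup>2 + b\<^sup>2 = a'\<^sup>2 + b'\<^sup>2" using E.semiaxes_sum M.semiaxes_sum by simp
  have M_ext: "16 * (a' * b')\<^sup>2 = ((B - A) \<bullet> (B - A)) * ((D - A) \<bullet> (D - A))"
    using M tangent_to_side_at_imp_mem by (intro M.midpoint_imp_extremal) (auto simp: midpoint_ellipse_def)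
  have "16 * (a * b)\<^sup>2 \<noteq> ((B - A) \<bullet> (B - A)) * ((D - A) \<bullet> (D - A))"
    using neq E.extremal_equation M.extremal_equation[OF M_ext] by blast
  then have "(a * b)\<^sup>2 < (a' * b')\<^sup>2" using E.semiaxes_prod_le M_ext by linarith
  moreover have "0 \<le> a' * b'" using M' by (auto simp: ellipse_with_def)
  ultimately show "a * b < a' * b'" by (rule power2_less_imp_less)
qed

lemma is_arg_max_unique:
  fixes f :: "'a \<Rightarrow> 'b::order"
  assumes "P m" "\<And>x. P x \<Longrightarrow> x \<noteq> m \<Longrightarrow> f x < f m"
  shows "is_arg_max f P x \<longleftrightarrow> x = m"
  using assms unfolding is_arg_max_def by (metis less_asym)

lemma is_arg_min_unique:
  fixes f :: "'a \<Rightarrow> 'b::order"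
  assumes "P m" "\<And>x. P x \<Longrightarrow> x \<noteq> m \<Longrightarrow> f m < f x"
  shows "is_arg_min f P x \<longleftrightarrow> x = m"
  using assms unfolding is_arg_min_def by (metis less_asym)

theorem theorem2:
  fixes A B C D :: point
  assumes "rectangle A B C D"
  shows "(\<exists>!E. midpoint_ellipse A B C D E) \<and>
    (\<forall>E\<^sub>M. midpoint_ellipse A B C D E\<^sub>M \<longrightarrow>
       (\<forall>E. is_arg_min eccentricity (inscribed A B C D) E \<longleftrightarrow> E = E\<^sub>M) \<and>
       (\<forall>E. is_arg_max ellipse_area (inscribed A B C D) E \<longleftrightarrow> E = E\<^sub>M) \<and>
       (\<forall>E. is_arg_max arc_length (inscribed A B C D) E \<longleftrightarrow> E = E\<^sub>M))"
proof -
  have better: "eccentricity M < eccentricity E \<and> ellipse_area E < ellipse_area M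
      \<and> arc_length E < arc_length M"
    if M: "midpoint_ellipse A B C D M" and E: "inscribed A B C D E" and neq: "E \<noteq> M" for M E
  proof -
    obtain c u v a b where e: "ellipse_with c u v a b E"
      using E by (auto simp: inscribed_def is_ellipse_def)
    obtain c' u' v' a' b' where m: "ellipse_with c' u' v' a' b' M"
      using M by (auto simp: midpoint_ellipse_def inscribed_def is_ellipse_def)
    have pos: "0 < b" "b \<le> a" "0 < b'" "b' \<le> a'"
      using e m by (auto simp: ellipse_with_def)
    note less = inscribed_eq_or_less[OF assms M E e m neq]
    show ?thesis
      unfolding eccentricity_ellipse[OF e] eccentricity_ellipse[OF m]
        ellipse_area_ellipse[OF e] ellipse_area_ellipse[OF m]
        arc_length_ellipse[OF e] arc_length_ellipse[OF m]
      using eccentricity_less[OF pos less] ellipse_perimeter_less[OF _ _ _ _ less] less(2) pos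
      by auto
  qed
  have ins: "inscribed A B C D M" if "midpoint_ellipse A B C D M" for M
    using that by (simp add: midpoint_ellipse_def)
  \<comment> \<open>Two distinct midpoint ellipses would each be strictly better than the
    other.\<close>
  have "\<exists>!E. midpoint_ellipse A B C D E"
    using midpoint_ellipse_exists[OF assms] better ins by (metis less_asym)
  then show ?thesis
    using better ins
    by (intro conjI allI impI is_arg_min_unique is_arg_max_unique) blast+
qed

end
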